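(* Let $\delta=hD_{con}$, where $h\in\mathbb{K}[y_2,\dots,y_m]$, and let $\theta\in\mathbb{T}$. Then the following statements are equivalent. (a) $\delta\theta(y_1)=\theta\delta(y_1)$. (b) $h\,\theta(y_1)=y_1\,\theta(h)$. (c) $\delta\theta(z)=\theta\delta(z)$. (d) $\theta\in\mathrm{Aut}(\delta)$. Moreover, if $\theta(h)=h$ (in particular, when $h\in\mathbb{K}^*$), statement (b) is equivalent to (b)$'$ $\theta(y_1)=y_1$.
   Context: $\mathbb{K}$ is an algebraically closed field of characteristic zero; $d,m,k_2,\dots,k_m$ are integers $\geqslant 2$. The Danielewski variety with constant coefficients $\mathbb{V}_{con}$ is the affine variety with coordinate ring $\mathbb{K}[\mathbb{V}_{con}]=\mathbb{K}[Y_1,\dots,Y_m,Z]/(Y_1Y_2^{k_2}\cdots Y_m^{k_m}-P(Z))$, where $P(Z)\in\mathbb{K}[Z]$ is monic of degree $d$; $y_1,\dots,y_m,z$ are the images of $Y_1,\dots,Y_m,Z$. The canonical locally nilpotent derivation $D_{con}$ is the $\mathbb{K}$-derivation with $D_{con}(y_1)=P'(z)$, $D_{con}(z)=y_2^{k_2}\cdots y_m^{k_m}$, $D_{con}(y_j)=0$ for $j\geqslant2$. $\mathbb{T}$ (the proper torus) is the group of automorphisms $\theta$ of $\mathbb{K}[\mathbb{V}_{con}]$ of the form $\theta(y_j)=\lambda_jy_j$ ($1\leqslant j\leqslant m$), $\theta(z)=z$, with $\lambda_j\in\mathbb{K}^*$ and $\lambda_1\lambda_2^{k_2}\cdots\lambda_m^{k_m}=1$.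 $\mathrm{Aut}(\delta)$ is the group of $\mathbb{K}$-algebra automorphisms of $\mathbb{K}[\mathbb{V}_{con}]$ commuting with $\delta$.
   Formalization: In the "Moreover" part, h ≠ 0 is assumed in addition to θ(h) = h: for h = 0 both θ(h) = h and (b) hold trivially, while (b)' fails for θ with λ_1 ≠ 1. The equivalence of (a)–(d) is stated for every h. *)

theory Defs
  imports
    "HOL-Library.Poly_Mapping"
    "HOL-Computational_Algebra.Polynomial"
    "HOL-Algebra.QuotRing"
    "HOL-Algebra.Bij"
begin

section \<open>Polynomial rings in a given set of variables\<close>

text \<open>A polynomial is a finitely supported map from monomials to coefficients, and a monomial is
  a finitely supported map from variables (natural numbers) to exponents; the product of
  \<^theory>\<open>HOL-Library.Poly_Mapping\<close> is the convolution product.\<close>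

type_synonym 'k mpoly = "(nat \<Rightarrow>\<^sub>0 nat) \<Rightarrow>\<^sub>0 'k"

definition mconst :: "'k::zero \<Rightarrow> 'k mpoly" where
  "mconst c = Poly_Mapping.single 0 c"

definition mvar :: "nat \<Rightarrow> 'k::zero_neq_one mpoly" where
  "mvar i = Poly_Mapping.single (Poly_Mapping.single i 1) 1"

definition mvars :: "'k::zero mpoly \<Rightarrow> nat set" where
  "mvars p = (\<Union>t\<in>Poly_Mapping.keys p. Poly_Mapping.keys t)"

definition mpoly_ring :: "nat set \<Rightarrow> 'k::comm_ring_1 mpoly ring" where
  "mpoly_ring V = \<lparr>carrier = {p. mvars p \<subseteq> V}, mult = (*), one = 1, zero = 0, add = (+)\<rparr>"

section \<open>Danielewski varieties with constant coefficients\<close>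

text \<open>Variable \<open>0\<close> stands for \<open>Z\<close> and variable \<open>j\<close>, for \<open>1 \<le> j \<le> m\<close>, for \<open>Y\<^sub>j\<close>.
  Only the values \<open>k j\<close> with \<open>2 \<le> j \<le> m\<close> matter.\<close>

definition poly_in_Z :: "'k::comm_ring_1 poly \<Rightarrow> 'k mpoly" where
  "poly_in_Z Q = poly (map_poly mconst Q) (mvar 0)"

definition danielewski_poly :: "nat \<Rightarrow> (nat \<Rightarrow> nat) \<Rightarrow> 'k::comm_ring_1 poly \<Rightarrow> 'k mpoly" where
  "danielewski_poly m k P = mvar 1 * (\<Prod>j\<in>{2..m}. mvar j ^ k j) - poly_in_Z P"

definition danielewski_ideal :: "nat \<Rightarrow> (nat \<Rightarrow> nat) \<Rightarrow> 'k::comm_ring_1 poly \<Rightarrow> 'k mpoly set" where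
  "danielewski_ideal m k P = PIdl\<^bsub>mpoly_ring {..m}\<^esub> (danielewski_poly m k P)"

definition coord_ring :: "nat \<Rightarrow> (nat \<Rightarrow> nat) \<Rightarrow> 'k::comm_ring_1 poly \<Rightarrow> 'k mpoly set ring" where
  "coord_ring m k P = mpoly_ring {..m} Quot danielewski_ideal m k P"

definition residue_class ::
    "nat \<Rightarrow> (nat \<Rightarrow> nat) \<Rightarrow> 'k::comm_ring_1 poly \<Rightarrow> 'k mpoly \<Rightarrow> 'k mpoly set" where
  "residue_class m k P p = danielewski_ideal m k P +>\<^bsub>mpoly_ring {..m}\<^esub> p"

text \<open>The images of \<open>Y\<^sub>j\<close>, of \<open>Z\<close> and of a scalar in the coordinate ring.\<close>

definition cy :: "nat \<Rightarrow> (nat \<Rightarrow> nat) \<Rightarrow> 'k::comm_ring_1 poly \<Rightarrow> nat \<Rightarrow> 'k mpoly set" where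
  "cy m k P j = residue_class m k P (mvar j)"

definition cz :: "nat \<Rightarrow> (nat \<Rightarrow> nat) \<Rightarrow> 'k::comm_ring_1 poly \<Rightarrow> 'k mpoly set" where
  "cz m k P = residue_class m k P (mvar 0)"

definition cscalar :: "nat \<Rightarrow> (nat \<Rightarrow> nat) \<Rightarrow> 'k::comm_ring_1 poly \<Rightarrow> 'k \<Rightarrow> 'k mpoly set" where
  "cscalar m k P c = residue_class m k P (mconst c)"

text \<open>The subalgebra generated over the scalars by \<open>y\<^sub>2, \<dots>, y\<^sub>m\<close>.\<close>

definition y_subalgebra :: "nat \<Rightarrow> (nat \<Rightarrow> nat) \<Rightarrow> 'k::comm_ring_1 poly \<Rightarrow> 'k mpoly set set" where
  "y_subalgebra m k P = residue_class m k P ` carrier (mpoly_ring {2..m})"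

section \<open>Derivations and automorphisms\<close>

definition K_derivation ::
    "nat \<Rightarrow> (nat \<Rightarrow> nat) \<Rightarrow> 'k::comm_ring_1 poly \<Rightarrow> ('k mpoly set \<Rightarrow> 'k mpoly set) \<Rightarrow> bool" where
  "K_derivation m k P D \<longleftrightarrow>
    (let A = coord_ring m k P in
      D \<in> carrier A \<rightarrow> carrier A \<and>
      (\<forall>a\<in>carrier A. \<forall>b\<in>carrier A. D (a \<oplus>\<^bsub>A\<^esub> b) = D a \<oplus>\<^bsub>A\<^esub> D b) \<and>
      (\<forall>c. \<forall>a\<in>carrier A. D (cscalar m k P c \<otimes>\<^bsub>A\<^esub> a) = cscalar m k P c \<otimes>\<^bsub>A\<^esub> D a) \<and>
      (\<forall>a\<in>carrier A. \<forall>b\<in>carrier A.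
        D (a \<otimes>\<^bsub>A\<^esub> b) = (D a \<otimes>\<^bsub>A\<^esub> b) \<oplus>\<^bsub>A\<^esub> (a \<otimes>\<^bsub>A\<^esub> D b)))"

text \<open>A derivation is determined on the carrier by its values on the generators, so this predicate
  singles out one map up to its irrelevant values outside the carrier.\<close>

definition canonical_derivation ::
    "nat \<Rightarrow> (nat \<Rightarrow> nat) \<Rightarrow> 'k::idom poly \<Rightarrow> ('k mpoly set \<Rightarrow> 'k mpoly set) \<Rightarrow> bool" where
  "canonical_derivation m k P D \<longleftrightarrow>
    K_derivation m k P D \<and>
    D (cy m k P 1) = residue_class m k P (poly_in_Z (pderiv P)) \<and>
    D (cz m k P) = residue_class m k P (\<Prod>j\<in>{2..m}. mvar j ^ k j) \<and>
    (\<forall>j\<in>{2..m}. D (cy m k P j) = \<zero>\<^bsub>coord_ring m k P\<^esub>)"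

text \<open>As in \<^const>\<open>BijGroup\<close>, automorphisms are taken to be undefined outside the carrier, so that
  equality of automorphisms is equality of functions.\<close>

definition K_automorphisms ::
    "nat \<Rightarrow> (nat \<Rightarrow> nat) \<Rightarrow> 'k::comm_ring_1 poly \<Rightarrow> ('k mpoly set \<Rightarrow> 'k mpoly set) set" where
  "K_automorphisms m k P =
    {\<theta> \<in> ring_hom (coord_ring m k P) (coord_ring m k P) \<inter> Bij (carrier (coord_ring m k P)).
      \<forall>c. \<theta> (cscalar m k P c) = cscalar m k P c}"

definition proper_torus ::
    "nat \<Rightarrow> (nat \<Rightarrow> nat) \<Rightarrow> 'k::comm_ring_1 poly \<Rightarrow> ('k mpoly set \<Rightarrow> 'k mpoly set) set" where
  "proper_torus m k P =
    {\<theta> \<in> K_automorphisms m k P.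
      \<exists>l::nat \<Rightarrow> 'k.
        (\<forall>j\<in>{1..m}. l j \<noteq> 0) \<and>
        l 1 * (\<Prod>j\<in>{2..m}. l j ^ k j) = 1 \<and>
        (\<forall>j\<in>{1..m}. \<theta> (cy m k P j) = cscalar m k P (l j) \<otimes>\<^bsub>coord_ring m k P\<^esub> cy m k P j) \<and>
        \<theta> (cz m k P) = cz m k P}"

definition Aut_deriv ::
    "nat \<Rightarrow> (nat \<Rightarrow> nat) \<Rightarrow> 'k::comm_ring_1 poly \<Rightarrow> ('k mpoly set \<Rightarrow> 'k mpoly set)
      \<Rightarrow> ('k mpoly set \<Rightarrow> 'k mpoly set) set" where
  "Aut_deriv m k P \<delta> =
    {\<theta> \<in> K_automorphisms m k P. \<forall>a\<in>carrier (coord_ring m k P). \<theta> (\<delta> a) = \<delta> (\<theta> a)}"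

section \<open>Basic facts\<close>

lemma mvars_add: "mvars (p + q) \<subseteq> mvars p \<union> mvars q"
  using Poly_Mapping.keys_add[of p q] by (auto simp: mvars_def)

lemma mvars_mult: "mvars (p * q) \<subseteq> mvars p \<union> mvars (q :: 'k::comm_ring_1 mpoly)"
proof
  fix i assume "i \<in> mvars (p * q)"
  then obtain t where t: "t \<in> Poly_Mapping.keys (p * q)" "i \<in> Poly_Mapping.keys t" by (auto simp: mvars_def)
  then obtain a b where ab: "a \<in> Poly_Mapping.keys p" "b \<in> Poly_Mapping.keys q" "t = a + b"
    using Poly_Mapping.keys_mult[of p q] by auto
  with t Poly_Mapping.keys_add[of a b] show "i \<in> mvars p \<union> mvars q" by (auto simp: mvars_def)
qed

lemma mvars_simps [simp]:
  "mvars 0 = {}" "mvars (1 :: 'k::comm_ring_1 mpoly) = {}"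
  "mvars (- r) = mvars (r :: 'k mpoly)" "mvars (mconst c) = {}"
  "mvars (mvar i :: 'k mpoly) = {i}"
  by (auto simp: mvars_def mconst_def mvar_def simp flip: single_one split: if_splits)

lemma mpoly_ring_cring: "cring (mpoly_ring V :: 'k::comm_ring_1 mpoly ring)"
proof (rule cringI)
  show "abelian_group (mpoly_ring V :: 'k mpoly ring)"
  proof (rule abelian_groupI)
    fix x :: "'k mpoly" assume "x \<in> carrier (mpoly_ring V)"
    then show "\<exists>y\<in>carrier (mpoly_ring V). y \<oplus>\<^bsub>mpoly_ring V\<^esub> x = \<zero>\<^bsub>mpoly_ring V\<^esub>"
      by (intro bexI[of _ "- x"]) (auto simp: mpoly_ring_def)
  qed (use mvars_add in \<open>fastforce simp: mpoly_ring_def algebra_simps\<close>)+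
  show "comm_monoid (mpoly_ring V :: 'k mpoly ring)"
    by (rule comm_monoidI) (use mvars_mult in \<open>fastforce simp: mpoly_ring_def algebra_simps\<close>)+
qed (auto simp: mpoly_ring_def algebra_simps)

end

(* Write theta(y_1) = l_1 y_1. As h and theta(h) lie in K[y_2,...,y_m], conditions (a), (b), (c) are
   the equation l_1 h = theta(h) multiplied by P'(z), y_1 and a scalar multiple of y_2^k_2 ... y_m^k_m.
   Since -(Y_1 Y_2^k_2 ... Y_m^k_m - P(Z)) is monic of degree d in Z, a nonzero multiple of it has
   Z-degree at least d. The lifts of both sides have Z-degree below d, so each condition holds
   already in the polynomial ring, where the factor cancels. Conversely, l_1 h = theta(h) makes
   delta theta and theta delta agree on the generators, hence everywhere by the Leibniz rule. *)

theory Submission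
  imports Defs
begin

section \<open>Multivariate polynomials\<close>

lemma mconst_0 [simp]: "mconst 0 = 0"
  by (simp add: mconst_def)

lemma mconst_1 [simp]: "mconst 1 = 1"
  by (simp add: mconst_def)

lemma mconst_eq_iff [simp]: "mconst a = mconst b \<longleftrightarrow> a = b"
  by (simp add: mconst_def inj_single inj_eq)

lemma mconst_mult: "mconst (a * b) = mconst a * (mconst b :: 'k::comm_ring_1 mpoly)"
  by (simp add: mconst_def mult_single)

lemma mvar_power: "mvar i ^ n = (Poly_Mapping.single (Poly_Mapping.single i n) 1 :: 'k::comm_ring_1 mpoly)"
  by (induction n) (simp_all add: mvar_def mult_single single_add[symmetric] flip: single_one)

lemma single_eq_mconst_mult: "Poly_Mapping.single t c = mconst c * Poly_Mapping.single t (1::'k::comm_ring_1)"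
  by (simp add: mconst_def mult_single)

lemma mvars_single: "mvars (Poly_Mapping.single t c) \<subseteq> Poly_Mapping.keys t"
  by (auto simp: mvars_def split: if_splits)

lemma mvars_diff: "mvars (p - q) \<subseteq> mvars p \<union> mvars (q :: 'k::comm_ring_1 mpoly)"
  using mvars_add[of p "- q"] by simp

lemma mvars_sum: "mvars (sum f S) \<subseteq> (\<Union>i\<in>S. mvars (f i :: 'k::comm_ring_1 mpoly))"
  by (induction S rule: infinite_finite_induct) (use mvars_add in fastforce)+

lemma mvars_power: "mvars (p ^ n) \<subseteq> mvars (p :: 'k::comm_ring_1 mpoly)"
  by (induction n) (use mvars_mult in fastforce)+

lemma mvars_prod: "mvars (prod f S) \<subseteq> (\<Union>i\<in>S. mvars (f i :: 'k::comm_ring_1 mpoly))"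
  by (induction S rule: infinite_finite_induct) (use mvars_mult in fastforce)+

section \<open>Expansion into monomials and induction over polynomials\<close>

lemma poly_mapping_sum_singles:
  "(p :: 'a \<Rightarrow>\<^sub>0 'b::comm_monoid_add) = (\<Sum>t\<in>Poly_Mapping.keys p. Poly_Mapping.single t (Poly_Mapping.lookup p t))"
proof (rule poly_mapping_eqI)
  fix s
  show "Poly_Mapping.lookup p s = Poly_Mapping.lookup (\<Sum>t\<in>Poly_Mapping.keys p. Poly_Mapping.single t (Poly_Mapping.lookup p t)) s"
    by (auto simp: lookup_sum lookup_single when_def in_keys_iff)
qed

lemma single_eq_prod_mvar:
  "Poly_Mapping.single t 1 = (\<Prod>i\<in>Poly_Mapping.keys t. mvar i ^ Poly_Mapping.lookup t i :: 'k::comm_ring_1 mpoly)"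
proof -
  have *: "(\<Prod>i\<in>S. Poly_Mapping.single (f i) 1) = (Poly_Mapping.single (sum f S) 1 :: 'k mpoly)"
    for f :: "nat \<Rightarrow> nat \<Rightarrow>\<^sub>0 nat" and S
    by (induction S rule: infinite_finite_induct) (simp_all add: mult_single)
  show ?thesis
    unfolding mvar_power * by (simp flip: poly_mapping_sum_singles)
qed

text \<open>Every polynomial is a finite sum of scalars times products of powers of its variables,
  so sums and products reach it from scalars and variables. Statements about homomorphisms and
  derivations of the coordinate ring thereby reduce to its generators.\<close>

lemma mpoly_induct [consumes 1, case_names const var add mult]:
  fixes p :: "'k::comm_ring_1 mpoly"
  assumes p: "mvars p \<subseteq> V"
    and const: "\<And>c. Q (mconst c)"
    and var: "\<And>i. i \<in> V \<Longrightarrow> Q (mvar i)"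
    and add: "\<And>p q. mvars p \<subseteq> V \<Longrightarrow> mvars q \<subseteq> V \<Longrightarrow> Q p \<Longrightarrow> Q q \<Longrightarrow> Q (p + q)"
    and mult: "\<And>p q. mvars p \<subseteq> V \<Longrightarrow> mvars q \<subseteq> V \<Longrightarrow> Q p \<Longrightarrow> Q q \<Longrightarrow> Q (p * q)"
  shows "Q p"
proof -
  \<comment> \<open>Packing the restriction on variables into the predicate makes closure under
    powers, products and finite sums free of side conditions.\<close>
  define Q' where "Q' p \<longleftrightarrow> mvars p \<subseteq> V \<and> Q p" for p
  have const': "Q' (mconst c)" for c
    using const by (simp add: Q'_def)
  have var': "Q' (mvar i)" if "i \<in> V" for i
    using var that by (simp add: Q'_def)
  have add': "Q' (p + q)" if "Q' p" "Q' q" for p q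
    using add[of p q] mvars_add[of p q] that by (auto simp: Q'_def)
  have mult': "Q' (p * q)" if "Q' p" "Q' q" for p q
    using mult[of p q] mvars_mult[of p q] that by (auto simp: Q'_def)
  have power': "Q' (p ^ n)" if "Q' p" for p n
    by (induction n) (use const'[of 1] mult' that in auto)
  have prod': "Q' (prod f S)" if "\<And>i. i \<in> S \<Longrightarrow> Q' (f i)" for f and S :: "nat set"
    using that
    by (induction S rule: infinite_finite_induct) (use const'[of 1] mult' in auto)
  have sum': "Q' (sum f S)" if "\<And>i. i \<in> S \<Longrightarrow> Q' (f i)" for f and S :: "(nat \<Rightarrow>\<^sub>0 nat) set"
    using that
    by (induction S rule: infinite_finite_induct) (use const'[of 0] add' in auto)
  have "Q' (Poly_Mapping.single t (Poly_Mapping.lookup p t))" if "t \<in> Poly_Mapping.keys p" for t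
    unfolding single_eq_mconst_mult[of t "Poly_Mapping.lookup p t"] single_eq_prod_mvar
    by (intro mult' const' prod' power' var') (use p that in \<open>auto simp: mvars_def\<close>)
  then have "Q' p"
    by (subst poly_mapping_sum_singles) (rule sum')
  then show ?thesis
    by (simp add: Q'_def)
qed

section \<open>Univariate polynomials in Z\<close>

lemma poly_in_Z_eq_sum:
  assumes "degree Q \<le> n"
  shows "poly_in_Z Q = (\<Sum>i\<le>n. Poly_Mapping.single (Poly_Mapping.single 0 i) (coeff Q i))"
proof -
  have "degree (map_poly mconst Q) \<le> n"
    using assms map_poly_degree_leq[of mconst Q] by linarith
  then have "poly_in_Z Q = (\<Sum>i\<le>n. coeff (map_poly mconst Q) i * mvar 0 ^ i)"
    unfolding poly_in_Z_def poly_altdef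
    by (intro sum.mono_neutral_left) (auto simp: coeff_eq_0)
  then show ?thesis
    by (simp add: coeff_map_poly mvar_power flip: single_eq_mconst_mult)
qed

lemma lookup_poly_in_Z: "Poly_Mapping.lookup (poly_in_Z Q) (Poly_Mapping.single 0 i) = coeff Q i"
proof -
  \<comment> \<open>The range is extended to the maximum so that it contains \<open>i\<close> even
    when \<open>i\<close> exceeds the degree.\<close>
  have "poly_in_Z Q = (\<Sum>j\<le>max i (degree Q). Poly_Mapping.single (Poly_Mapping.single 0 j) (coeff Q j))"
    by (rule poly_in_Z_eq_sum) simp
  then show ?thesis
    by (simp add: lookup_sum lookup_single when_def inj_eq inj_single)
qed

lemma mvars_poly_in_Z: "mvars (poly_in_Z Q) \<subseteq> {0}"
proof -
  have "mvars (Poly_Mapping.single (Poly_Mapping.single 0 i) c) \<subseteq> {0}" for i and c :: 'a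
    using mvars_single[of "Poly_Mapping.single 0 i" c] by (auto split: if_splits)
  then show ?thesis
    unfolding poly_in_Z_eq_sum[OF order_refl] using mvars_sum by blast
qed

lemma poly_in_Z_eq_0_iff [simp]: "poly_in_Z Q = 0 \<longleftrightarrow> Q = 0"
proof
  assume "poly_in_Z Q = 0"
  then have "coeff Q i = 0" for i
    by (simp flip: lookup_poly_in_Z)
  then show "Q = 0"
    by (simp add: poly_eq_iff)
qed (simp add: poly_in_Z_def)

section \<open>Degree in \<open>Z\<close>\<close>

text \<open>A bound on each monomial instead of a degree function: the zero polynomial satisfies
  every bound, so no convention for its degree is required.\<close>

definition zdeg_less :: "nat \<Rightarrow> 'k::zero mpoly \<Rightarrow> bool" where
  "zdeg_less n p \<longleftrightarrow> (\<forall>t\<in>Poly_Mapping.keys p. Poly_Mapping.lookup t 0 < n)"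

lemma lookup_eq_0_if_zdeg_less: "zdeg_less n p \<Longrightarrow> n \<le> Poly_Mapping.lookup t 0 \<Longrightarrow> Poly_Mapping.lookup p t = 0"
  by (auto simp: zdeg_less_def in_keys_iff simp flip: not_le)

lemma zdeg_less_diff:
  "zdeg_less n p \<Longrightarrow> zdeg_less n q \<Longrightarrow> zdeg_less n (p - q :: 'k::comm_ring_1 mpoly)"
  using Poly_Mapping.keys_diff[of p q] by (auto simp: zdeg_less_def)

lemma zdeg_less_sum:
  "(\<And>i. i \<in> S \<Longrightarrow> zdeg_less n (f i)) \<Longrightarrow> zdeg_less n (sum f S :: 'k::comm_ring_1 mpoly)"
  by (induction S rule: infinite_finite_induct)
     (use Poly_Mapping.keys_add in \<open>fastforce simp: zdeg_less_def\<close>)+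

text \<open>Z-exponents add under multiplication, and one below \<open>a\<close> plus one at most
  \<open>b\<close> lies below \<open>a + b\<close>; \<open>Suc b\<close> turns "at most
  \<open>b\<close>" into a strict bound. With \<open>b = 0\<close>, multiplying by a Z-free factor
  keeps the bound \<open>a\<close>.\<close>

lemma zdeg_less_mult:
  assumes "zdeg_less a p" "zdeg_less (Suc b) q"
  shows "zdeg_less (a + b) (p * q :: 'k::comm_ring_1 mpoly)"
  using keys_mult[of p q] assms by (fastforce simp: zdeg_less_def lookup_add)

lemma zdeg_less_free: "0 \<notin> mvars p \<Longrightarrow> n > 0 \<Longrightarrow> zdeg_less n p"
  by (auto simp: zdeg_less_def mvars_def in_keys_iff)

lemma zdeg_less_poly_in_Z:
  assumes "degree Q < n"
  shows "zdeg_less n (poly_in_Z Q)"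
  unfolding poly_in_Z_eq_sum[OF order_refl]
  by (rule zdeg_less_sum) (use assms in \<open>auto simp: zdeg_less_def split: if_splits\<close>)

text \<open>Leading-term argument: if \<open>q\<close> were nonzero with Z-degree \<open>e\<close>,
  the part of \<open>F * q\<close> of Z-degree \<open>d + e\<close> would be Z^d times the top part
  of \<open>q\<close>, and the leading coefficient 1 cannot annihilate it.\<close>

lemma monic_in_Z_mult_eq_0:
  fixes F q :: "'k::comm_ring_1 mpoly"
  assumes F: "zdeg_less d (F - mvar 0 ^ d)" and Fq: "zdeg_less d (F * q)"
  shows "q = 0"
proof (rule ccontr)
  assume "q \<noteq> 0"
  define Z where "Z = Poly_Mapping.single (0::nat) d"
  define e where "e = Max ((\<lambda>t. Poly_Mapping.lookup t 0) ` Poly_Mapping.keys q)"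
  have ne: "Poly_Mapping.keys q \<noteq> {}"
    using \<open>q \<noteq> 0\<close> by simp
  have "e \<in> (\<lambda>t. Poly_Mapping.lookup t 0) ` Poly_Mapping.keys q"
    unfolding e_def by (rule Max_in) (use ne in auto)
  then obtain t where t: "t \<in> Poly_Mapping.keys q" "Poly_Mapping.lookup t 0 = e"
    by blast
  \<comment> \<open>\<open>e\<close> is the Z-degree of \<open>q\<close>, so the lower terms of
    \<open>F\<close> contribute nothing to the coefficient at \<open>Z + t\<close>.\<close>
  have "zdeg_less (Suc e) q"
    by (auto simp: zdeg_less_def e_def less_Suc_eq_le)
  with F have "zdeg_less (d + e) ((F - mvar 0 ^ d) * q)"
    by (rule zdeg_less_mult)
  moreover have "Poly_Mapping.lookup (Z + t) 0 = d + e"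
    by (simp add: Z_def lookup_add t)
  ultimately have low: "Poly_Mapping.lookup ((F - mvar 0 ^ d) * q) (Z + t) = 0"
    by (simp add: lookup_eq_0_if_zdeg_less)
  \<comment> \<open>Addition of monomials is cancellative, so only \<open>t\<close> is mapped to
    \<open>Z + t\<close>.\<close>
  have "Poly_Mapping.lookup (Poly_Mapping.single Z 1 * q) (Z + t) = Poly_Mapping.lookup q t"
    by (simp add: lookup_mult lookup_single when_mult mult_when)
  moreover have "F * q = Poly_Mapping.single Z 1 * q + (F - mvar 0 ^ d) * q"
    by (simp add: mvar_power Z_def algebra_simps)
  ultimately have "Poly_Mapping.lookup (F * q) (Z + t) \<noteq> 0"
    using low t by (simp add: lookup_add in_keys_iff)
  with Fq \<open>Poly_Mapping.lookup (Z + t) 0 = d + e\<close> show False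
    by (simp add: lookup_eq_0_if_zdeg_less)
qed

section \<open>The coordinate ring\<close>

locale danielewski =
  fixes m :: nat and k :: "nat \<Rightarrow> nat" and P :: "'k::field_char_0 poly"
  assumes m_pos: "1 \<le> m" and degree_pos: "1 \<le> degree P" and monic: "lead_coeff P = 1"
begin

abbreviation "R \<equiv> mpoly_ring {..m} :: 'k mpoly ring"
abbreviation "I \<equiv> danielewski_ideal m k P"
abbreviation "A \<equiv> coord_ring m k P"
abbreviation "r \<equiv> residue_class m k P"
text \<open>This monomial plays two parts: it is the cofactor of Y_1 in the defining equation and
  represents D_con(z).\<close>

abbreviation "M \<equiv> (\<Prod>j\<in>{2..m}. mvar j ^ k j) :: 'k mpoly"

lemma mvars_M: "mvars M \<subseteq> {2..m}"
proof -
  have "mvars (mvar j ^ k j :: 'k mpoly) \<subseteq> {j}" for j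
    using mvars_power[of "mvar j" "k j"] by simp
  then show ?thesis
    using mvars_prod[of "\<lambda>j. mvar j ^ k j :: 'k mpoly" "{2..m}"] by blast
qed

lemma mvar_nonzero: "mvar j \<noteq> (0 :: 'k mpoly)"
  by (metis insert_not_empty mvars_simps(1,5))

lemma M_nonzero: "M \<noteq> 0"
  by (simp add: mvar_nonzero)

lemma danielewski_poly_in_R: "danielewski_poly m k P \<in> carrier R"
proof -
  have "mvars (danielewski_poly m k P) \<subseteq> mvars (mvar 1 * M) \<union> mvars (poly_in_Z P)"
    unfolding danielewski_poly_def by (rule mvars_diff)
  then show ?thesis
    using mvars_mult[of "mvar 1" M] mvars_M mvars_poly_in_Z[of P] m_pos
    by (fastforce simp: mpoly_ring_def)
qed

lemma I_ideal: "ideal I R"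
  unfolding danielewski_ideal_def
  by (rule cring.cgenideal_ideal[OF mpoly_ring_cring danielewski_poly_in_R])

lemma A_cring: "cring A"
  unfolding coord_ring_def by (rule ideal.quotient_is_cring[OF I_ideal mpoly_ring_cring])

lemma r_eq: "r = (+>\<^bsub>R\<^esub>) I"
  by (simp add: residue_class_def fun_eq_iff)

lemma r_hom: "r \<in> ring_hom R A"
  unfolding r_eq coord_ring_def by (rule ideal.rcos_ring_hom[OF I_ideal])

lemma r_closed: "mvars p \<subseteq> {..m} \<Longrightarrow> r p \<in> carrier A"
  using ring_hom_closed[OF r_hom, of p] by (simp add: mpoly_ring_def)

lemma r_add: "mvars p \<subseteq> {..m} \<Longrightarrow> mvars q \<subseteq> {..m} \<Longrightarrow> r (p + q) = r p \<oplus>\<^bsub>A\<^esub> r q"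
  using ring_hom_add[OF r_hom, of p q] by (simp add: mpoly_ring_def)

lemma r_mult: "mvars p \<subseteq> {..m} \<Longrightarrow> mvars q \<subseteq> {..m} \<Longrightarrow> r (p * q) = r p \<otimes>\<^bsub>A\<^esub> r q"
  using ring_hom_mult[OF r_hom, of p q] by (simp add: mpoly_ring_def)

lemma r_one: "r 1 = \<one>\<^bsub>A\<^esub>"
  using ring_hom_one[OF r_hom] by (simp add: mpoly_ring_def)

lemma r_zero: "r 0 = \<zero>\<^bsub>A\<^esub>"
  using ring_hom_zero[OF r_hom cring.axioms(1)[OF mpoly_ring_cring] cring.axioms(1)[OF A_cring]]
  by (simp add: mpoly_ring_def)

lemma carrier_A: "carrier A = r ` {p. mvars p \<subseteq> {..m}}"
  by (auto simp: coord_ring_def FactRing_simps r_eq a_r_coset_def mpoly_ring_def)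

section \<open>Equality and cancellation of residue classes\<close>

lemma r_eqD:
  assumes "mvars p \<subseteq> {..m}" "mvars q \<subseteq> {..m}" "r p = r q"
  obtains x where "p - q = danielewski_poly m k P * x"
proof -
  interpret ideal I R by (rule I_ideal)
  have "p \<in> I +>\<^bsub>R\<^esub> p"
    using a_rcos_self assms(1) by (simp add: mpoly_ring_def)
  then have "p \<in> I +>\<^bsub>R\<^esub> q"
    using assms(3) by (simp add: r_eq)
  then obtain x where "p = x * danielewski_poly m k P + q"
    by (auto simp: a_r_coset_def' danielewski_ideal_def cgenideal_def mpoly_ring_def)
  then show thesis
    by (intro that[of x]) (simp add: algebra_simps)
qed

text \<open>P enters the defining polynomial with a minus sign, so its negative is the one that is
  monic in Z. Beyond Z^d there remain the lower terms of P and the Z-free product Y_1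
  \<open>M\<close>, whose Z-degree 0 is below the positive degree of P.\<close>

lemma zdeg_danielewski_poly: "zdeg_less (degree P) (- danielewski_poly m k P - mvar 0 ^ degree P)"
proof -
  have "poly_in_Z P = (\<Sum>i<degree P. Poly_Mapping.single (Poly_Mapping.single 0 i) (coeff P i)) + mvar 0 ^ degree P"
    unfolding poly_in_Z_eq_sum[OF order_refl] mvar_power
    using monic by (simp flip: lessThan_Suc_atMost)
  moreover have "zdeg_less (degree P) (\<Sum>i<degree P. Poly_Mapping.single (Poly_Mapping.single 0 i) (coeff P i))"
    by (rule zdeg_less_sum) (auto simp: zdeg_less_def split: if_splits)
  moreover have "zdeg_less (degree P) (mvar 1 * M)"
    by (rule zdeg_less_free) (use mvars_mult[of "mvar 1" M] mvars_M degree_pos in auto)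
  ultimately show ?thesis
    unfolding danielewski_poly_def by (simp add: zdeg_less_diff)
qed

text \<open>The difference \<open>w * (p - q)\<close> has Z-degree below that of P and is a multiple
  of a polynomial monic in Z of that degree, hence zero. The factor \<open>w\<close> then cancels in
  the polynomial ring, which is a domain; whether \<open>A\<close> is one does not enter.\<close>

lemma r_mult_cancel:
  assumes p: "mvars p \<subseteq> {2..m}" and q: "mvars q \<subseteq> {2..m}" and w: "mvars w \<subseteq> {..m}"
    and zdeg: "zdeg_less (degree P) w" and "w \<noteq> 0"
  shows "r p \<otimes>\<^bsub>A\<^esub> r w = r q \<otimes>\<^bsub>A\<^esub> r w \<longleftrightarrow> p = q"
proof
  assume eq: "r p \<otimes>\<^bsub>A\<^esub> r w = r q \<otimes>\<^bsub>A\<^esub> r w"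
  have pq: "mvars p \<subseteq> {..m}" "mvars q \<subseteq> {..m}"
    using p q by auto
  have "r (p * w) = r (q * w)"
    using eq pq w by (simp add: r_mult)
  then obtain x where x: "p * w - q * w = danielewski_poly m k P * x"
    using r_eqD[of "p * w" "q * w"] mvars_mult[of p w] mvars_mult[of q w] pq w by blast
  \<comment> \<open>The bound \<open>Suc 0\<close> expresses that Z does not occur.\<close>
  have "zdeg_less (Suc 0) (p - q)"
    by (rule zdeg_less_free) (use mvars_diff[of p q] p q in fastforce)+
  with zdeg have "zdeg_less (degree P + 0) (w * (p - q))"
    by (rule zdeg_less_mult)
  moreover have "w * (p - q) = (- danielewski_poly m k P) * (- x)"
    using x by (simp add: algebra_simps)
  ultimately have "- x = 0"
    using monic_in_Z_mult_eq_0[OF zdeg_danielewski_poly, of "- x"] by simp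
  then have "(p - q) * w = 0"
    using x by (simp add: algebra_simps)
  then show "p = q"
    using \<open>w \<noteq> 0\<close> by simp
qed simp

text \<open>Cancellation with \<open>w = 1\<close>: y_2, ..., y_m are algebraically independent, so
  elements of their subalgebra have a unique Z-free and Y_1-free representative.\<close>

lemma r_inject:
  assumes p: "mvars p \<subseteq> {2..m}" and q: "mvars q \<subseteq> {2..m}"
  shows "r p = r q \<longleftrightarrow> p = q"
proof
  assume "r p = r q"
  moreover have "zdeg_less (degree P) (1 :: 'k mpoly)"
    by (rule zdeg_less_free) (use degree_pos in auto)
  ultimately show "p = q"
    using r_mult_cancel[OF p q, of 1] by simp
qed simp

section \<open>Automorphisms that scale or fix generators\<close>

text \<open>Supplies a representative of \<theta>(h) in Y_2, ..., Y_m only, the form in which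
  cancellation applies. It exists because each generator goes to a scalar multiple of
  itself.\<close>

lemma automorphism_y_subalgebra:
  assumes \<theta>: "\<theta> \<in> K_automorphisms m k P"
    and \<theta>_y: "\<And>j. j \<in> {2..m} \<Longrightarrow> \<theta> (cy m k P j) = cscalar m k P (l j) \<otimes>\<^bsub>A\<^esub> cy m k P j"
    and p: "mvars p \<subseteq> {2..m}"
  obtains p' where "mvars p' \<subseteq> {2..m}" "\<theta> (r p) = r p'"
proof -
  have hom: "\<theta> \<in> ring_hom A A"
    using \<theta> by (simp add: K_automorphisms_def)
  have le: "mvars q \<subseteq> {..m}" if "mvars q \<subseteq> {2..m}" for q :: "'k mpoly"
    using that by auto
  have "\<exists>p'. mvars p' \<subseteq> {2..m} \<and> \<theta> (r p) = r p'"
    using p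
  proof (induction p rule: mpoly_induct)
    case (const c)
    then show ?case
      using \<theta> by (intro exI[of _ "mconst c"]) (simp add: K_automorphisms_def cscalar_def)
  next
    case (var j)
    then have "\<theta> (r (mvar j)) = r (mconst (l j) * mvar j)"
      using \<theta>_y by (simp add: cy_def cscalar_def r_mult)
    moreover have "mvars (mconst (l j) * mvar j) \<subseteq> {2..m}"
      using mvars_mult[of "mconst (l j)" "mvar j"] var by auto
    ultimately show ?case
      by blast
  next
    case (add p q)
    then obtain p' q' where "mvars p' \<subseteq> {2..m}" "\<theta> (r p) = r p'" "mvars q' \<subseteq> {2..m}" "\<theta> (r q) = r q'"
      by blast
    with add.hyps show ?case
      using mvars_add[of p' q']
      by (intro exI[of _ "p' + q'"]) (auto simp: r_add r_closed le ring_hom_add[OF hom])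
  next
    case (mult p q)
    then obtain p' q' where "mvars p' \<subseteq> {2..m}" "\<theta> (r p) = r p'" "mvars q' \<subseteq> {2..m}" "\<theta> (r q) = r q'"
      by blast
    with mult.hyps show ?case
      using mvars_mult[of p' q']
      by (intro exI[of _ "p' * q'"]) (auto simp: r_mult r_closed le ring_hom_mult[OF hom])
  qed
  then show thesis
    using that by blast
qed

text \<open>Applied with V consisting of Z alone, this gives \<theta>(P'(z)) = P'(z).\<close>

lemma automorphism_fixes:
  assumes \<theta>: "\<theta> \<in> K_automorphisms m k P"
    and V: "V \<subseteq> {..m}" "\<And>i. i \<in> V \<Longrightarrow> \<theta> (r (mvar i)) = r (mvar i)"
    and p: "mvars p \<subseteq> V"
  shows "\<theta> (r p) = r p"
proof -
  have hom: "\<theta> \<in> ring_hom A A"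
    using \<theta> by (simp add: K_automorphisms_def)
  have le: "mvars q \<subseteq> {..m}" if "mvars q \<subseteq> V" for q :: "'k mpoly"
    using that V(1) by auto
  show ?thesis
    using p
  proof (induction p rule: mpoly_induct)
    case (const c)
    then show ?case
      using \<theta> by (simp add: K_automorphisms_def cscalar_def)
  qed (simp_all add: V(2) r_add r_mult r_closed le ring_hom_add[OF hom] ring_hom_mult[OF hom])
qed

lemma automorphism_M:
  assumes \<theta>: "\<theta> \<in> K_automorphisms m k P"
    and \<theta>_y: "\<And>j. j \<in> {2..m} \<Longrightarrow> \<theta> (cy m k P j) = cscalar m k P (l j) \<otimes>\<^bsub>A\<^esub> cy m k P j"
  shows "\<theta> (r M) = r (mconst (\<Prod>j\<in>{2..m}. l j ^ k j) * M)"
proof -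
  have hom: "\<theta> \<in> ring_hom A A"
    using \<theta> by (simp add: K_automorphisms_def)
  have one: "\<theta> (r 1) = r 1"
    using ring_hom_one[OF hom] by (simp add: r_one)
  \<comment> \<open>Scaling factors multiply along with the elements they scale; this one fact
    drives both the induction on exponents and the one on the index set.\<close>
  have mult: "\<theta> (r (p * q)) = r ((a * b) * (p * q))"
    if "\<theta> (r p) = r (a * p)" "\<theta> (r q) = r (b * q)" "mvars p \<subseteq> {..m}" "mvars q \<subseteq> {..m}"
      "mvars a \<subseteq> {..m}" "mvars b \<subseteq> {..m}" for p q a b
  proof -
    have "\<theta> (r (p * q)) = r (a * p) \<otimes>\<^bsub>A\<^esub> r (b * q)"
      using that by (simp add: r_mult r_closed ring_hom_mult[OF hom])
    also have "\<dots> = r ((a * p) * (b * q))"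
      using that mvars_mult[of a p] mvars_mult[of b q] by (subst r_mult) auto
    finally show ?thesis
      by (simp add: mult_ac)
  qed
  have var: "\<theta> (r (mvar j)) = r (mconst (l j) * mvar j)" if "j \<in> {2..m}" for j
    using \<theta>_y[OF that] that by (simp add: cy_def cscalar_def r_mult)
  have in_R: "mvars (mvar j ^ n :: 'k mpoly) \<subseteq> {..m}" if "j \<in> {2..m}" for j n
    using mvars_power[of "mvar j :: 'k mpoly" n] that by auto
  have power: "\<theta> (r (mvar j ^ n)) = r (mconst (l j ^ n) * mvar j ^ n)" if "j \<in> {2..m}" for j n
  proof (induction n)
    case (Suc n)
    then show ?case
      using mult[OF var[OF that] Suc] that in_R[OF that] by (simp add: mconst_mult)
  qed (simp add: one)
  \<comment> \<open>Stated for subsets \<open>S\<close> so that the induction keeps every index in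
    the range where \<theta> is known to scale.\<close>
  have "\<theta> (r (\<Prod>j\<in>S. mvar j ^ k j)) = r (mconst (\<Prod>j\<in>S. l j ^ k j) * (\<Prod>j\<in>S. mvar j ^ k j))"
    if "finite S" "S \<subseteq> {2..m}" for S
    using that
  proof (induction S rule: finite_induct)
    case (insert j S)
    have "mvars (\<Prod>j\<in>S. mvar j ^ k j :: 'k mpoly) \<subseteq> {..m}"
      using mvars_prod[of "\<lambda>j. mvar j ^ k j :: 'k mpoly" S] in_R insert.prems by blast
    then show ?case
      using mult[OF power[of j "k j"] insert.IH] insert in_R[of j "k j"] by (simp add: mconst_mult)
  qed (simp add: one)
  then show ?thesis
    by simp
qed

section \<open>Derivations of the coordinate ring\<close>

text \<open>The Leibniz rule at 1 * 1 gives D(1) = D(1) + D(1), so D(1) = 0, and linearity carries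
  this to all scalars.\<close>

lemma derivation_cscalar:
  assumes "K_derivation m k P D"
  shows "D (cscalar m k P c) = \<zero>\<^bsub>A\<^esub>"
proof -
  interpret A: cring A
    by (rule A_cring)
  have D: "D \<in> carrier A \<rightarrow> carrier A"
    and scalar: "\<And>a. a \<in> carrier A \<Longrightarrow> D (cscalar m k P c \<otimes>\<^bsub>A\<^esub> a) = cscalar m k P c \<otimes>\<^bsub>A\<^esub> D a"
    and leibniz: "\<And>a b. a \<in> carrier A \<Longrightarrow> b \<in> carrier A \<Longrightarrow>
      D (a \<otimes>\<^bsub>A\<^esub> b) = (D a \<otimes>\<^bsub>A\<^esub> b) \<oplus>\<^bsub>A\<^esub> (a \<otimes>\<^bsub>A\<^esub> D b)"
    using assms by (simp_all add: K_derivation_def Let_def)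
  have c: "cscalar m k P c \<in> carrier A"
    by (simp add: cscalar_def r_closed)
  have D1: "D \<one>\<^bsub>A\<^esub> \<in> carrier A"
    using D by auto
  then have "D \<one>\<^bsub>A\<^esub> = D \<one>\<^bsub>A\<^esub> \<oplus>\<^bsub>A\<^esub> D \<one>\<^bsub>A\<^esub>"
    using leibniz[of "\<one>\<^bsub>A\<^esub>" "\<one>\<^bsub>A\<^esub>"] by simp
  then have "D \<one>\<^bsub>A\<^esub> = \<zero>\<^bsub>A\<^esub>"
    using D1 A.add.l_cancel_one' by metis
  then show ?thesis
    using scalar[of "\<one>\<^bsub>A\<^esub>"] c by simp
qed

text \<open>Both composites are additive and satisfy the same Leibniz rule twisted by \<theta>, and
  both vanish on scalars, so agreement spreads from the generators to sums and products.\<close>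

lemma commute_if_commute_on_generators:
  assumes \<theta>: "\<theta> \<in> K_automorphisms m k P" and \<delta>: "K_derivation m k P \<delta>"
    and gen: "\<And>i. i \<le> m \<Longrightarrow> \<theta> (\<delta> (r (mvar i))) = \<delta> (\<theta> (r (mvar i)))"
    and "a \<in> carrier A"
  shows "\<theta> (\<delta> a) = \<delta> (\<theta> a)"
proof -
  have hom: "\<theta> \<in> ring_hom A A" and \<theta>_scalar: "\<theta> (cscalar m k P c) = cscalar m k P c" for c
    using \<theta> by (simp_all add: K_automorphisms_def)
  have closed: "\<delta> u \<in> carrier A" "\<theta> u \<in> carrier A" if "u \<in> carrier A" for u
    using that \<delta> ring_hom_closed[OF hom] by (auto simp: K_derivation_def Let_def)
  have add: "\<delta> (u \<oplus>\<^bsub>A\<^esub> v) = \<delta> u \<oplus>\<^bsub>A\<^esub> \<delta> v"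
    and leibniz: "\<delta> (u \<otimes>\<^bsub>A\<^esub> v) = (\<delta> u \<otimes>\<^bsub>A\<^esub> v) \<oplus>\<^bsub>A\<^esub> (u \<otimes>\<^bsub>A\<^esub> \<delta> v)"
    if "u \<in> carrier A" "v \<in> carrier A" for u v
    using \<delta> that by (simp_all add: K_derivation_def Let_def)
  interpret A: cring A
    by (rule A_cring)
  obtain p where "mvars p \<subseteq> {..m}" "a = r p"
    using \<open>a \<in> carrier A\<close> carrier_A by auto
  then show ?thesis
  proof (induction p arbitrary: a rule: mpoly_induct)
    case (const c)
    have "\<theta> \<zero>\<^bsub>A\<^esub> = \<zero>\<^bsub>A\<^esub>"
      using \<theta>_scalar[of 0] by (simp add: cscalar_def r_zero)
    with const show ?case
      using derivation_cscalar[OF \<delta>, of c] \<theta>_scalar[of c] by (simp add: cscalar_def)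
  qed (simp_all add: gen r_add r_mult r_closed closed add leibniz ring_hom_add[OF hom] ring_hom_mult[OF hom])
qed

lemma derivation_multiple:
  assumes "K_derivation m k P D" and h: "h \<in> carrier A"
  shows "K_derivation m k P (\<lambda>u. h \<otimes>\<^bsub>A\<^esub> D u)"
proof -
  interpret A: cring A
    by (rule A_cring)
  have "cscalar m k P c \<in> carrier A" for c
    by (simp add: cscalar_def r_closed)
  moreover have "D u \<in> carrier A" if "u \<in> carrier A" for u
    using assms that by (auto simp: K_derivation_def Let_def)
  ultimately show ?thesis
    using assms by (auto simp: K_derivation_def Let_def A.r_distr A.m_ac)
qed

end

section \<open>The equivalences for elements of the proper torus\<close>

theorem proposition5p2:
  fixes P :: "'k::{alg_closed_field, field_char_0} poly"
    and d m :: nat and k :: "nat \<Rightarrow> nat"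
    and Dcon \<delta> \<theta> :: "'k mpoly set \<Rightarrow> 'k mpoly set" and h :: "'k mpoly set"
  assumes "d \<ge> 2" and "m \<ge> 2" and "\<And>j. j \<in> {2..m} \<Longrightarrow> k j \<ge> 2"
    and "degree P = d" and "lead_coeff P = 1"
    and "canonical_derivation m k P Dcon"
    and "h \<in> y_subalgebra m k P"
    and "\<delta> = (\<lambda>u. h \<otimes>\<^bsub>coord_ring m k P\<^esub> Dcon u)"
    and "\<theta> \<in> proper_torus m k P"
  shows "let A = coord_ring m k P; y\<^sub>1 = cy m k P 1; z = cz m k P;
      a = (\<delta> (\<theta> y\<^sub>1) = \<theta> (\<delta> y\<^sub>1));
      b = (h \<otimes>\<^bsub>A\<^esub> \<theta> y\<^sub>1 = y\<^sub>1 \<otimes>\<^bsub>A\<^esub> \<theta> h);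
      c = (\<delta> (\<theta> z) = \<theta> (\<delta> z));
      e = (\<theta> \<in> Aut_deriv m k P \<delta>);
      b' = (\<theta> y\<^sub>1 = y\<^sub>1)
    in (a \<longleftrightarrow> b) \<and> (b \<longleftrightarrow> c) \<and> (c \<longleftrightarrow> e) \<and>
      (\<theta> h = h \<and> h \<noteq> \<zero>\<^bsub>A\<^esub> \<longrightarrow> (b \<longleftrightarrow> b')) \<and>
      ((\<exists>\<mu>. \<mu> \<noteq> 0 \<and> h = cscalar m k P \<mu>) \<longrightarrow> \<theta> h = h \<and> (b \<longleftrightarrow> b'))"
proof -
  interpret danielewski m k P
    using assms by unfold_locales auto
  interpret A: cring A
    by (rule A_cring)
  note One_nat_def [simp del]
  note \<delta>_def = \<open>\<delta> = (\<lambda>u. h \<otimes>\<^bsub>A\<^esub> Dcon u)\<close>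
  let ?P' = "poly_in_Z (pderiv P)"
  have D: "K_derivation m k P Dcon" "Dcon (cy m k P 1) = r ?P'" "Dcon (cz m k P) = r M"
      "\<And>j. j \<in> {2..m} \<Longrightarrow> Dcon (cy m k P j) = \<zero>\<^bsub>A\<^esub>"
    using assms(6) by (auto simp: canonical_derivation_def)
  have D_scalar: "Dcon (cscalar m k P c \<otimes>\<^bsub>A\<^esub> a) = cscalar m k P c \<otimes>\<^bsub>A\<^esub> Dcon a"
    if "a \<in> carrier A" for c a
    using D(1) that by (auto simp: K_derivation_def Let_def)
  obtain l where \<theta>: "\<theta> \<in> K_automorphisms m k P"
    and l: "l 1 * (\<Prod>j\<in>{2..m}. l j ^ k j) = 1"
    and \<theta>_y: "\<And>j. j \<in> {1..m} \<Longrightarrow> \<theta> (cy m k P j) = cscalar m k P (l j) \<otimes>\<^bsub>A\<^esub> cy m k P j"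
    and \<theta>_z: "\<theta> (cz m k P) = cz m k P"
    using assms(9) by (auto simp: proper_torus_def)
  \<comment> \<open>\<open>L\<close> is the factor by which \<theta> scales \<open>M\<close>; the
    torus relation makes it the inverse of \<open>l 1\<close>.\<close>
  define L where "L = (\<Prod>j\<in>{2..m}. l j ^ k j)"
  have L: "l 1 * L = 1"
    using l by (simp add: L_def)
  have hom: "\<theta> \<in> ring_hom A A" and \<theta>_scalar: "\<And>c. \<theta> (cscalar m k P c) = cscalar m k P c"
    using \<theta> by (simp_all add: K_automorphisms_def)
  have \<theta>_zero: "\<theta> \<zero>\<^bsub>A\<^esub> = \<zero>\<^bsub>A\<^esub>"
    using \<theta>_scalar[of 0] by (simp add: cscalar_def r_zero)
  have \<theta>_y2: "\<theta> (cy m k P j) = cscalar m k P (l j) \<otimes>\<^bsub>A\<^esub> cy m k P j" if "j \<in> {2..m}" for j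
    using \<theta>_y that by simp
  have \<theta>_y1: "\<theta> (cy m k P 1) = cscalar m k P (l 1) \<otimes>\<^bsub>A\<^esub> cy m k P 1"
    using \<theta>_y assms(2) by simp
  obtain p where p: "mvars p \<subseteq> {2..m}" "h = r p"
    using assms(7) by (auto simp: y_subalgebra_def mpoly_ring_def)
  obtain p' where p': "mvars p' \<subseteq> {2..m}" "\<theta> h = r p'"
    using automorphism_y_subalgebra[OF \<theta> \<theta>_y2 p(1)] p(2) by metis
  have c_closed [simp]: "cscalar m k P c \<in> carrier A" for c
    by (simp add: cscalar_def r_closed)
  have y_closed [simp]: "cy m k P j \<in> carrier A" if "j \<le> m" for j
    using that by (simp add: cy_def r_closed)
  have z_closed [simp]: "cz m k P \<in> carrier A"
    by (simp add: cz_def r_closed)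
  have subs: "{2..m} \<subseteq> {..m}"
    by auto
  have in_R: "mvars p \<subseteq> {..m}" "mvars p' \<subseteq> {..m}" "mvars M \<subseteq> {..m}" "mvars ?P' \<subseteq> {..m}"
    using p(1) p'(1) mvars_M mvars_poly_in_Z[of "pderiv P"] by (auto dest!: subsetD)
  have h_closed [simp]: "h \<in> carrier A" "\<theta> h \<in> carrier A"
    using p p' in_R by (simp_all add: r_closed)
  have [simp]: "r M \<in> carrier A" "r ?P' \<in> carrier A"
    using in_R by (simp_all add: r_closed)
  have scal: "cscalar m k P c \<otimes>\<^bsub>A\<^esub> r q = r (mconst c * q)" if "mvars q \<subseteq> {..m}" for c q
    using that by (simp add: cscalar_def r_mult)
  have scal_in: "mvars (mconst c * q) \<subseteq> {2..m}" if "mvars q \<subseteq> {2..m}" for c and q :: "'k mpoly"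
    using mvars_mult[of "mconst c" q] that by auto
  have \<delta>: "K_derivation m k P \<delta>"
    unfolding \<delta>_def by (rule derivation_multiple[OF D(1)]) simp
  have \<theta>_P': "\<theta> (r ?P') = r ?P'"
    by (rule automorphism_fixes[OF \<theta>, of "{0}"])
       (use \<theta>_z mvars_poly_in_Z in \<open>auto simp: cz_def\<close>)
  have \<theta>_M: "\<theta> (r M) = cscalar m k P L \<otimes>\<^bsub>A\<^esub> r M"
    using automorphism_M[OF \<theta> \<theta>_y2] in_R(3) by (simp add: scal L_def)

  \<comment> \<open>The lift of l_1 h = \<theta>(h) to polynomials. Each of the four conditions is
    compared with it, which yields all the equivalences.\<close>
  define eq where "eq \<longleftrightarrow> mconst (l 1) * p = p'"
  have cancel: "(cscalar m k P (l 1) \<otimes>\<^bsub>A\<^esub> h) \<otimes>\<^bsub>A\<^esub> r w = \<theta> h \<otimes>\<^bsub>A\<^esub> r w \<longleftrightarrow> eq"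
    if "mvars w \<subseteq> {..m}" "zdeg_less d w" "w \<noteq> 0" for w
    using r_mult_cancel[OF scal_in[OF p(1)] p'(1), of w "l 1"] that in_R assms(4)
    unfolding p'(2) unfolding p(2) by (simp add: scal eq_def)

  have a: "\<delta> (\<theta> (cy m k P 1)) = \<theta> (\<delta> (cy m k P 1)) \<longleftrightarrow> eq"
  proof -
    have "\<delta> (\<theta> (cy m k P 1)) = (cscalar m k P (l 1) \<otimes>\<^bsub>A\<^esub> h) \<otimes>\<^bsub>A\<^esub> r ?P'"
      using m_pos unfolding \<delta>_def \<theta>_y1 by (subst D_scalar) (simp_all add: D(2) A.m_ac)
    moreover have "\<theta> (\<delta> (cy m k P 1)) = \<theta> h \<otimes>\<^bsub>A\<^esub> r ?P'"
      by (simp add: \<delta>_def D(2) ring_hom_mult[OF hom] \<theta>_P')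
    \<comment> \<open>Differentiation lowers the degree to d - 1, and characteristic zero keeps P'
      nonzero.\<close>
    moreover have "zdeg_less d ?P'"
      by (rule zdeg_less_poly_in_Z) (use assms in \<open>simp add: degree_pderiv\<close>)
    moreover have "?P' \<noteq> 0"
      using assms by (simp add: pderiv_eq_0_iff)
    ultimately show ?thesis
      using cancel[of ?P'] in_R by simp
  qed

  have b: "h \<otimes>\<^bsub>A\<^esub> \<theta> (cy m k P 1) = cy m k P 1 \<otimes>\<^bsub>A\<^esub> \<theta> h \<longleftrightarrow> eq"
  proof -
    have "h \<otimes>\<^bsub>A\<^esub> \<theta> (cy m k P 1) = (cscalar m k P (l 1) \<otimes>\<^bsub>A\<^esub> h) \<otimes>\<^bsub>A\<^esub> cy m k P 1"
      using m_pos by (simp add: \<theta>_y1 A.m_ac)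
    moreover have "cy m k P 1 \<otimes>\<^bsub>A\<^esub> \<theta> h = \<theta> h \<otimes>\<^bsub>A\<^esub> cy m k P 1"
      using m_pos by (simp add: A.m_comm)
    moreover have "zdeg_less d (mvar 1 :: 'k mpoly)"
      by (rule zdeg_less_free) (use assms in auto)
    ultimately show ?thesis
      using cancel[of "mvar 1"] m_pos mvar_nonzero by (simp add: cy_def)
  qed

  have c: "\<delta> (\<theta> (cz m k P)) = \<theta> (\<delta> (cz m k P)) \<longleftrightarrow> eq"
  proof -
    have "L \<noteq> 0"
      using L by auto
    have "\<delta> (\<theta> (cz m k P)) = h \<otimes>\<^bsub>A\<^esub> r M"
      by (simp add: \<delta>_def \<theta>_z D(3))
    \<comment> \<open>Inserting l_1 \<open>L\<close> = 1 gives this side the same right factor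
      \<open>L\<close> \<open>M\<close> that \<theta>(\<open>M\<close>) produces on the
      other.\<close>
    also have "\<dots> = (cscalar m k P (l 1) \<otimes>\<^bsub>A\<^esub> h) \<otimes>\<^bsub>A\<^esub> r (mconst L * M)"
    proof -
      have "(mconst (l 1) * p) * (mconst L * M) = mconst (l 1 * L) * (p * M)"
        by (simp only: mconst_mult mult_ac)
      then have "r (p * M) = r ((mconst (l 1) * p) * (mconst L * M))"
        by (simp only: L mconst_1 mult_1)
      then show ?thesis
        using in_R scal_in[OF p(1), of "l 1"] scal_in[OF mvars_M, of L] subs
        by (subst (asm) (1 2) r_mult) (auto simp: p(2) scal)
    qed
    finally have "\<delta> (\<theta> (cz m k P)) = (cscalar m k P (l 1) \<otimes>\<^bsub>A\<^esub> h) \<otimes>\<^bsub>A\<^esub> r (mconst L * M)" .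
    moreover have "\<theta> (\<delta> (cz m k P)) = \<theta> h \<otimes>\<^bsub>A\<^esub> r (mconst L * M)"
      using in_R by (simp add: \<delta>_def D(3) ring_hom_mult[OF hom] \<theta>_M scal)
    moreover have "zdeg_less d (mconst L * M)"
      by (rule zdeg_less_free) (use assms scal_in[OF mvars_M, of L] in auto)
    moreover have "mconst L * M \<noteq> 0"
      using \<open>L \<noteq> 0\<close> M_nonzero mconst_eq_iff[of L 0] by simp
    ultimately show ?thesis
      using cancel[OF subset_trans[OF scal_in[OF mvars_M, of L] subs]] by simp
  qed

  have e: "\<theta> \<in> Aut_deriv m k P \<delta> \<longleftrightarrow> eq"
  proof
    assume "\<theta> \<in> Aut_deriv m k P \<delta>"
    then show eq
      using c by (auto simp: Aut_deriv_def)
  next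
    assume eq
    have "\<theta> (\<delta> (r (mvar i))) = \<delta> (\<theta> (r (mvar i)))" if "i \<le> m" for i
    proof -
      consider "i = 0" | "i = 1" | "i \<in> {2..m}"
        using \<open>i \<le> m\<close> atLeastAtMost_iff[of i 2 m] by linarith
      then show ?thesis
      proof cases
        case 1
        then show ?thesis
          using c \<open>eq\<close> by (simp add: cz_def)
      next
        case 2
        then show ?thesis
          using a \<open>eq\<close> by (simp add: cy_def)
      next
        case 3
        \<comment> \<open>Both sides vanish: D_con kills y_i, and \<theta> only scales it.\<close>
        have "\<theta> (\<delta> (cy m k P i)) = \<delta> (\<theta> (cy m k P i))"
          using 3 by (simp add: \<delta>_def D(4) \<theta>_y2 D_scalar \<theta>_zero)
        then show ?thesis
          by (simp add: cy_def)
      qed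
    qed
    then show "\<theta> \<in> Aut_deriv m k P \<delta>"
      using commute_if_commute_on_generators[OF \<theta> \<delta>] \<theta> by (auto simp: Aut_deriv_def)
  qed

  \<comment> \<open>For h = 0 condition (b) holds for every \<theta> in the torus, so h must be
    nonzero before \<open>p\<close> can be cancelled from l_1 \<open>p\<close> =
    \<open>p\<close>.\<close>
  have b': "eq \<longleftrightarrow> \<theta> (cy m k P 1) = cy m k P 1" if "\<theta> h = h" "h \<noteq> \<zero>\<^bsub>A\<^esub>"
  proof
    assume eq
    have "p' = p"
      using r_inject[OF p'(1) p(1)] p p' that(1) by simp
    moreover have "p \<noteq> 0"
      using that(2) p(2) r_zero by auto
    ultimately have "mconst (l 1) = (1 :: 'k mpoly)"
      using \<open>eq\<close> by (simp add: eq_def)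
    then have "cscalar m k P (l 1) = \<one>\<^bsub>A\<^esub>"
      by (simp add: cscalar_def r_one)
    then show "\<theta> (cy m k P 1) = cy m k P 1"
      using \<theta>_y1 m_pos by simp
  next
    assume "\<theta> (cy m k P 1) = cy m k P 1"
    then show eq
      using b that(1) m_pos by (simp add: A.m_comm)
  qed
  \<comment> \<open>A nonzero scalar is fixed by \<theta> and stays nonzero in \<open>A\<close> by
    injectivity on Z-free and Y_1-free representatives.\<close>
  have scalar: "\<theta> h = h \<and> h \<noteq> \<zero>\<^bsub>A\<^esub>" if "\<mu> \<noteq> 0" "h = cscalar m k P \<mu>" for \<mu>
    using that \<theta>_scalar r_inject[of "mconst \<mu>" 0] mconst_eq_iff[of \<mu> 0] r_zero
    by (simp add: cscalar_def)
  show ?thesis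
    unfolding Let_def a b c e using b' scalar by blast
qed

end
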